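(* Let $A$ be an $n\times n$ complex diagonal matrix, regarded as an operator on the reproducing kernel Hilbert space $\mathbb{C}^n$. Then its numerical range is the convex hull of its Berezin range, i.e., $$W(A)=\left\{\sum_{i=1}^{n}|\lambda_i|^2\widetilde{A}(i)\,:\,\lambda_1,\dots,\lambda_n\in\mathbb{C},\ \sum_{i=1}^{n}|\lambda_i|^2=1\right\}.$$
   Context: $\mathbb{C}^n$ is viewed as a reproducing kernel Hilbert space of functions on $\{1,\dots,n\}$ with the standard inner product; its reproducing kernel at $i$ is the standard basis vector $e_i$. For an $n\times n$ matrix $A$, the Berezin transform is $\widetilde{A}(i)=\langle Ae_i,e_i\rangle$ for $1\le i\le n$, the Berezin range is $\mathrm{Ber}(A)=\{\widetilde{A}(i):1\le i\le n\}$, and the numerical range is $W(A)=\{\langle Au,u\rangle:u\in\mathbb{C}^n,\ \|u\|=1\}$. *)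

theory Defs
  imports "HOL-Analysis.Analysis"
begin

text \<open>The standard inner product, linear in the first argument. The library's
  \<open>inner\<close> on \<open>complex ^ 'n\<close> is only its real part; the library's \<open>norm\<close> is the norm it
  induces, see \<open>cinner_self\<close>.\<close>

definition cinner :: "complex ^ 'n \<Rightarrow> complex ^ 'n \<Rightarrow> complex" where
  "cinner u v = (\<Sum>i\<in>UNIV. u $ i * cnj (v $ i))"

lemma cinner_self: "cinner u u = complex_of_real ((norm u)\<^sup>2)"
  by (simp add: cinner_def norm_vec_def L2_set_def sum_nonneg
      complex_norm_square [symmetric])

definition rep_kernel :: "'n \<Rightarrow> complex ^ 'n" where
  "rep_kernel i = axis i 1"

lemma cinner_rep_kernel: "cinner f (rep_kernel i) = f $ i"
proof -
  have "cinner f (rep_kernel i) = (\<Sum>j\<in>UNIV. if j = i then f $ j else 0)"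
    unfolding cinner_def rep_kernel_def by (rule sum.cong) (auto simp: axis_def)
  then show ?thesis by simp
qed

text \<open>The kernel functions are unit vectors, so no normalisation is needed here.\<close>

definition berezin_transform :: "complex ^ 'n ^ 'n \<Rightarrow> 'n \<Rightarrow> complex" where
  "berezin_transform A i = cinner (A *v rep_kernel i) (rep_kernel i)"

definition berezin_range :: "complex ^ 'n ^ 'n \<Rightarrow> complex set" where
  "berezin_range A = {berezin_transform A i | i. True}"

definition numerical_range :: "complex ^ 'n ^ 'n \<Rightarrow> complex set" where
  "numerical_range A = {cinner (A *v u) u | u. norm u = 1}"

definition diagonal_matrix :: "complex ^ 'n ^ 'n \<Rightarrow> bool" where
  "diagonal_matrix A \<longleftrightarrow> (\<forall>i j. i \<noteq> j \<longrightarrow> A $ i $ j = 0)"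

end

theory Submission
  imports Defs
begin

text \<open>A diagonal matrix acts coordinatewise, so its quadratic form at \<open>u\<close> is the sum of
  the diagonal entries, which are the values of the Berezin transform, with weights
  \<open>\<bar>u\<^sub>i\<bar>\<^sup>2\<close> (\<open>cinner_diagonal_matrix\<close>). As \<open>u\<close> runs over the unit sphere, its
  coordinates run over all families with \<open>\<Sum>\<^sub>i \<bar>\<lambda>\<^sub>i\<bar>\<^sup>2 = 1\<close>, which gives
  the explicit description. The weights in turn run over all nonnegative families with
  sum \<open>1\<close>, because each such family consists of the squares of its square roots; hence the
  values are exactly the convex combinations of the Berezin range
  (\<open>convex_hull_range_finite\<close>).\<close>

lemma berezin_transform_eq_diagonal_entry: "berezin_transform A i = A $ i $ i"
proof -
  have "(\<Sum>j\<in>UNIV. A $ i $ j * (if j = i then 1 else 0)) = A $ i $ i"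
    by (simp add: if_distrib cong: if_cong)
  then show ?thesis
    unfolding berezin_transform_def cinner_rep_kernel
    by (simp add: matrix_vector_mult_def rep_kernel_def axis_def)
qed

lemma diagonal_matrix_mult_vector_nth:
  assumes "diagonal_matrix A"
  shows "(A *v u) $ i = A $ i $ i * u $ i"
proof -
  have "(A *v u) $ i = (\<Sum>j\<in>UNIV. if j = i then A $ i $ i * u $ i else 0)"
    unfolding matrix_vector_mult_def vec_lambda_beta
    using assms by (intro sum.cong) (auto simp: diagonal_matrix_def)
  then show ?thesis by simp
qed

lemma cinner_diagonal_matrix:
  assumes "diagonal_matrix A"
  shows "cinner (A *v u) u
    = (\<Sum>i\<in>UNIV. complex_of_real ((cmod (u $ i))\<^sup>2) * berezin_transform A i)"
  unfolding cinner_def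
  by (rule sum.cong)
    (simp_all add: diagonal_matrix_mult_vector_nth [OF assms]
      berezin_transform_eq_diagonal_entry complex_norm_square mult_ac del: of_real_power)

lemma norm_vec_eq_1_iff: "norm u = 1 \<longleftrightarrow> (\<Sum>i\<in>UNIV. (norm (u $ i))\<^sup>2) = 1"
  by (simp add: norm_vec_def L2_set_def)

text \<open>The family may repeat values, as the diagonal of a matrix does, so the coefficients are
  indexed by the parameter and not by the points of the range. The right-hand side contains
  each \<open>f i\<close> and is convex, since convex combinations of coefficient families are again
  coefficient families; so minimality of the hull gives the first inclusion.\<close>

lemma convex_hull_range_finite:
  fixes f :: "'i::finite \<Rightarrow> 'a::real_vector"
  shows "convex hull (range f)
    = {\<Sum>i\<in>UNIV. c i *\<^sub>R f i | c. (\<forall>i. 0 \<le> c i) \<and> sum c UNIV = 1}" (is "_ = ?S")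
proof
  have "f i \<in> ?S" for i
  proof -
    have "(\<Sum>j\<in>UNIV. (if j = i then 1 else 0) *\<^sub>R f j) = (\<Sum>j\<in>UNIV. if j = i then f j else 0)"
      by (rule sum.cong) auto
    then have "f i = (\<Sum>j\<in>UNIV. (if j = i then 1 else 0) *\<^sub>R f j)"
      by simp
    then show ?thesis
      by (intro CollectI exI [of _ "\<lambda>j. if j = i then 1 else 0"]) auto
  qed
  moreover have "convex ?S"
  proof (rule convexI)
    fix x y and s t :: real
    assume "x \<in> ?S" "y \<in> ?S" and st: "0 \<le> s" "0 \<le> t" "s + t = 1"
    then obtain c d where
      c: "x = (\<Sum>i\<in>UNIV. c i *\<^sub>R f i)" "\<forall>i. 0 \<le> c i" "sum c UNIV = 1" and
      d: "y = (\<Sum>i\<in>UNIV. d i *\<^sub>R f i)" "\<forall>i. 0 \<le> d i" "sum d UNIV = 1"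
      by blast
    have "s *\<^sub>R x + t *\<^sub>R y = (\<Sum>i\<in>UNIV. (s * c i + t * d i) *\<^sub>R f i)"
      by (simp add: c(1) d(1) scaleR_sum_right sum.distrib scaleR_add_left)
    moreover have "\<forall>i. 0 \<le> s * c i + t * d i"
      using st c d by simp
    moreover have "(\<Sum>i\<in>UNIV. s * c i + t * d i) = 1"
      using st c d by (simp add: sum.distrib flip: sum_distrib_left)
    ultimately show "s *\<^sub>R x + t *\<^sub>R y \<in> ?S"
      by (intro CollectI exI [of _ "\<lambda>i. s * c i + t * d i"]) simp
  qed
  ultimately show "convex hull (range f) \<subseteq> ?S"
    by (intro hull_minimal) auto
  show "?S \<subseteq> convex hull (range f)"
    by (auto intro!: convex_sum [OF _ convex_convex_hull] simp: hull_inc)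
qed

theorem theorem5p2:
  fixes A :: "complex ^ 'n ^ 'n"
  assumes "diagonal_matrix A"
  shows "numerical_range A = convex hull (berezin_range A) \<and>
    numerical_range A =
      {\<Sum>i\<in>UNIV. complex_of_real ((cmod (l i))\<^sup>2) * berezin_transform A i
        | l :: 'n \<Rightarrow> complex. (\<Sum>i\<in>UNIV. (cmod (l i))\<^sup>2) = 1}"
    (is "_ \<and> _ = ?L")
proof -
  have W: "numerical_range A = ?L"
  proof
    show "numerical_range A \<subseteq> ?L"
      by (auto simp: numerical_range_def cinner_diagonal_matrix [OF assms] norm_vec_eq_1_iff)
    show "?L \<subseteq> numerical_range A"
    proof
      fix z assume "z \<in> ?L"
      then obtain l :: "'n \<Rightarrow> complex" where
        z: "z = (\<Sum>i\<in>UNIV. complex_of_real ((cmod (l i))\<^sup>2) * berezin_transform A i)" and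
        l: "(\<Sum>i\<in>UNIV. (cmod (l i))\<^sup>2) = 1"
        by blast
      have "norm (\<chi> i. l i) = 1" "z = cinner (A *v (\<chi> i. l i)) (\<chi> i. l i)"
        by (simp_all add: norm_vec_eq_1_iff l z cinner_diagonal_matrix [OF assms])
      then show "z \<in> numerical_range A"
        unfolding numerical_range_def by blast
    qed
  qed
  have "?L = {\<Sum>i\<in>UNIV. c i *\<^sub>R berezin_transform A i | c. (\<forall>i. 0 \<le> c i) \<and> sum c UNIV = 1}"
    (is "_ = ?C")
  proof
    show "?L \<subseteq> ?C"
    proof
      fix z assume "z \<in> ?L"
      then obtain l :: "'n \<Rightarrow> complex" where
        "z = (\<Sum>i\<in>UNIV. complex_of_real ((cmod (l i))\<^sup>2) * berezin_transform A i)"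
        "(\<Sum>i\<in>UNIV. (cmod (l i))\<^sup>2) = 1"
        by blast
      then show "z \<in> ?C"
        by (intro CollectI exI [of _ "\<lambda>i. (cmod (l i))\<^sup>2"]) (simp add: scaleR_conv_of_real)
    qed
    show "?C \<subseteq> ?L"
    proof
      fix z assume "z \<in> ?C"
      then obtain c where
        "z = (\<Sum>i\<in>UNIV. c i *\<^sub>R berezin_transform A i)" "\<forall>i. 0 \<le> c i" "sum c UNIV = 1"
        by blast
      \<comment> \<open>The square roots of the weights serve as coordinates.\<close>
      then show "z \<in> ?L"
        by (intro CollectI exI [of _ "\<lambda>i. complex_of_real (sqrt (c i))"])
          (simp add: scaleR_conv_of_real flip: of_real_power)
    qed
  qed
  also have "\<dots> = convex hull (berezin_range A)"
    by (simp add: berezin_range_def full_SetCompr_eq convex_hull_range_finite)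
  finally show ?thesis
    using W by simp
qed

end
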